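(* Let $N\ge1$, let $S$ be an $N\times N$ matrix polynomial with $\det S\not\equiv0$, let $q$ be a scalar polynomial without zeros on the unit circle $\mathbb{T}$, and let $A(t)=S(t)/q(t)$. Let $p_1,\dots,p_N$ be the diagonal polynomials of the Smith canonical form of $S$, let $t_1,\dots,t_r$ be the distinct zeros of $\det A$ on $\mathbb{T}$, and let the integers $\beta_{j,i}\ge0$ and $\kappa_j\in\mathbb{Z}$ $(1\le j\le N,\ 1\le i\le r)$ be defined by the representations $$\frac{p_j(t)}{q(t)}=(t-t_1)^{\beta_{j,1}}\cdots(t-t_r)^{\beta_{j,r}}\,t^{\kappa_j}\,r_j^-(t)\,r_j^+(t),$$ where $r_j^+$ and $r_j^-$ are rational functions having no zeros and no poles in $|t|\le1$ and in $1\le|t|\le\infty$, respectively. Suppose that $\kappa_1\ge0$ and $\kappa_N>0$. Then the condition numbers $\kappa(T_n(A))$ grow at least exponentially, i.e. there are positive numbers $c,\gamma$ such that $\kappa(T_n(A))\ge c\,e^{\gamma n}$ for all $n\ge1$.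
   Context: Smith canonical form: $S(t)=G_+(t)\,\mathrm{diag}(p_1(t),\dots,p_N(t))\,H_+(t)$, where $G_+,H_+$ are matrix polynomials with constant nonzero determinants and $p_j$ are monic scalar polynomials with $p_{j-1}\mid p_j$ for $j=2,\dots,N$. Consequently $\beta_{1,i}\le\cdots\le\beta_{N,i}$ for each $i$ and $\kappa_1\le\cdots\le\kappa_N$. With Fourier coefficients $\hat A_k=\frac1{2\pi}\int_0^{2\pi}A(e^{i\theta})e^{-ik\theta}\,d\theta$, $T_n(A)=(\hat A_{j-k})_{j,k=0}^{n-1}\in\mathbb{C}^{nN\times nN}$. For a square matrix $M$, $\kappa(M)=\|M\|\,\|M^{-1}\|$ with the spectral norm, and $\kappa(M)=\infty$ if $M$ is not invertible (not to be confused with the integers $\kappa_j$). *)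

theory Defs
  imports
    "HOL-Analysis.Analysis"
    "HOL-Computational_Algebra.Field_as_Ring"
    "HOL-Computational_Algebra.Polynomial_Factorial"
    "HOL-Library.Extended_Real"
    "Jordan_Normal_Form.Gauss_Jordan_Elimination"
    "Jordan_Normal_Form.Determinant"
begin

unbundle no vec_syntax

hide_const (open)
  Finite_Cartesian_Product.vec Finite_Cartesian_Product.mat Finite_Cartesian_Product.row
  Determinants.det

section \<open>Rational functions\<close>

text \<open>Rational functions are elements of the field \<open>complex poly fract\<close>. Since
  \<^const>\<open>quot_of_fract\<close> returns a coprime numerator and denominator, the zeros and poles below
  are those of the reduced fraction. The zero function vanishes everywhere on the
  Riemann sphere.\<close>

definition rat_num :: "complex poly fract \<Rightarrow> complex poly" where
  "rat_num f = fst (quot_of_fract f)"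

definition rat_den :: "complex poly fract \<Rightarrow> complex poly" where
  "rat_den f = snd (quot_of_fract f)"

definition rat_eval :: "complex poly fract \<Rightarrow> complex \<Rightarrow> complex" where
  "rat_eval f z = poly (rat_num f) z / poly (rat_den f) z"

definition rat_zero_at :: "complex poly fract \<Rightarrow> complex \<Rightarrow> bool" where
  "rat_zero_at f z \<longleftrightarrow> poly (rat_num f) z = 0"

definition rat_pole_at :: "complex poly fract \<Rightarrow> complex \<Rightarrow> bool" where
  "rat_pole_at f z \<longleftrightarrow> poly (rat_den f) z = 0"

definition rat_zero_at_infinity :: "complex poly fract \<Rightarrow> bool" where
  "rat_zero_at_infinity f \<longleftrightarrow> f = 0 \<or> degree (rat_num f) < degree (rat_den f)"

definition rat_pole_at_infinity :: "complex poly fract \<Rightarrow> bool" where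
  "rat_pole_at_infinity f \<longleftrightarrow> degree (rat_num f) > degree (rat_den f)"

definition plus_factor :: "complex poly fract \<Rightarrow> bool" where
  "plus_factor f \<longleftrightarrow> (\<forall>z. norm z \<le> 1 \<longrightarrow> \<not> rat_zero_at f z \<and> \<not> rat_pole_at f z)"

definition minus_factor :: "complex poly fract \<Rightarrow> bool" where
  "minus_factor f \<longleftrightarrow> (\<forall>z. norm z \<ge> 1 \<longrightarrow> \<not> rat_zero_at f z \<and> \<not> rat_pole_at f z) \<and>
     \<not> rat_zero_at_infinity f \<and> \<not> rat_pole_at_infinity f"

section \<open>Smith canonical form\<close>

text \<open>The diagonal polynomials are indexed by \<open>1, \<dots>, N\<close>, whereas matrix indices start at \<open>0\<close>.\<close>

definition smith_diagonal ::
    "nat \<Rightarrow> complex poly mat \<Rightarrow> (nat \<Rightarrow> complex poly) \<Rightarrow> bool" where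
  "smith_diagonal N S p \<longleftrightarrow>
     (\<exists>G H. G \<in> carrier_mat N N \<and> H \<in> carrier_mat N N \<and>
        (\<exists>c. c \<noteq> 0 \<and> det G = [:c:]) \<and> (\<exists>c. c \<noteq> 0 \<and> det H = [:c:]) \<and>
        S = G * mat_diag N (\<lambda>i. p (Suc i)) * H) \<and>
     (\<forall>j\<in>{1..N}. lead_coeff (p j) = 1) \<and>
     (\<forall>j\<in>{2..N}. p (j - 1) dvd p j)"

section \<open>Block Toeplitz matrices\<close>

definition fourier_coeff :: "(complex \<Rightarrow> complex) \<Rightarrow> int \<Rightarrow> complex" where
  "fourier_coeff a k =
     1 / (2 * of_real pi) *
     integral {0..2 * pi} (\<lambda>\<theta>. a (exp (\<i> * of_real \<theta>)) * exp (- (\<i> * of_int k * of_real \<theta>)))"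

text \<open>Row \<open>i\<close> of the \<open>nN \<times> nN\<close> matrix is row \<open>i mod N\<close> of block row \<open>i div N\<close>, and likewise
  for columns.\<close>

definition block_toeplitz :: "nat \<Rightarrow> complex poly fract mat \<Rightarrow> nat \<Rightarrow> complex mat" where
  "block_toeplitz N A n = mat (n * N) (n * N) (\<lambda>(i, j).
     fourier_coeff (rat_eval (A $$ (i mod N, j mod N))) (int (i div N) - int (j div N)))"

section \<open>Spectral norm and condition number\<close>

definition euclidean_norm :: "complex vec \<Rightarrow> real" where
  "euclidean_norm v = sqrt (\<Sum>i<dim_vec v. (norm (v $ i))\<^sup>2)"

definition spectral_norm :: "complex mat \<Rightarrow> real" where
  "spectral_norm M =
     (SUP v \<in> {v \<in> carrier_vec (dim_col M). euclidean_norm v \<le> 1}. euclidean_norm (M *\<^sub>v v))"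

definition condition_number :: "complex mat \<Rightarrow> ereal" where
  "condition_number M =
     (case mat_inverse M of
        None \<Rightarrow> \<infinity>
      | Some M' \<Rightarrow> ereal (spectral_norm M * spectral_norm M'))"

end

theory Submission
  imports
    Defs
    "HOL-Computational_Algebra.Fundamental_Theorem_Algebra"
    "HOL-Complex_Analysis.Cauchy_Integral_Formula"
begin

unbundle no vec_syntax

hide_const (open)
  Finite_Cartesian_Product.vec Finite_Cartesian_Product.mat Finite_Cartesian_Product.row
  Determinants.det

text \<open>
  A nonsingular Toeplitz matrix \<open>T\<close> is badly conditioned as soon as some row vector \<open>y\<close> makes
  \<open>y T\<close> tiny compared with \<open>y\<close>. Such vectors come from the infinite Toeplitz operator: suppose that
  \<open>Y(z) = \<Sum>k\<ge>0. y\<^sub>k / z\<^sup>k\<^sup>+\<^sup>1\<close> is a nonzero row of proper rational functions with all poles in the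
  open unit disk and that \<open>Y A\<close> is holomorphic on the closed disk. By Cauchy's theorem the
  coefficients of \<open>Y A\<close> at the negative powers vanish, which says that \<open>(y\<^sub>0, y\<^sub>1, \<dots>)\<close> annihilates the
  semi-infinite block Toeplitz matrix. Because the \<open>y\<^sub>k\<close> decay geometrically, truncating after
  \<open>n\<close> blocks leaves a vector whose norm is bounded below while its product with \<open>T\<^sub>n(A)\<close> is
  \<open>O(\<rho>\<^sup>n)\<close> for some \<open>\<rho> < 1\<close>. For large \<open>n\<close> the norm of \<open>T\<^sub>n(A)\<close> is at least the modulus of any given
  Fourier coefficient of an entry of \<open>A\<close>, which may be taken nonzero; if there is none, every \<open>T\<^sub>n(A)\<close> is the zero matrix and is not invertible. This is the
  content of \<open>condition_number_exponential_if_annihilated\<close>.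

  It remains to find \<open>Y\<close>. Call the monic factor that carries the zeros in the open disk the inner
  part of a polynomial. Let \<open>d\<close> be the inner part of \<open>p\<^sub>N\<close> and factor \<open>q = q\<^sub>1 q\<^sub>2\<close> with \<open>q\<^sub>1\<close> the inner
  part of \<open>q\<close>. Counting zeros in the disk in the given representations shows that the inner part
  of \<open>p\<^sub>j\<close> has degree \<open>deg q\<^sub>1 + \<kappa>\<^sub>j\<close> for \<open>j = 1\<close> and \<open>j = N\<close>. Look for \<open>Y = v q\<^sub>1 / d\<close> with a row \<open>v\<close>
  of polynomials of degree less than \<open>\<kappa>\<^sub>N = deg d - deg q\<^sub>1\<close>. Then \<open>Y A = v S / (d q\<^sub>2)\<close>, so the
  requirement is that \<open>d\<close> divides \<open>v S = v G diag(p\<^sub>j) H\<close>, and for this it suffices that each entry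
  \<open>(v G)\<^sub>j\<close> is divisible by the quotient \<open>Q\<^sub>j\<close> of \<open>d\<close> by the inner part of \<open>p\<^sub>j\<close>. These are at most
  \<open>deg Q\<^sub>j \<le> \<kappa>\<^sub>N\<close> linear conditions for each \<open>j\<close>, by \<open>p\<^sub>1 dvd p\<^sub>j\<close> and \<open>\<kappa>\<^sub>1 \<ge> 0\<close>, and none at all for \<open>j = N\<close>.
  Altogether there are at most \<open>(N - 1) \<kappa>\<^sub>N\<close> conditions on \<open>N \<kappa>\<^sub>N > 0\<close> coefficients, so a nonzero \<open>v\<close>
  exists; this is \<open>exists_row_with_divisibilities\<close>.
\<close>

section \<open>Zeros of a polynomial in the open unit disk\<close>

definition inner_roots :: "complex poly \<Rightarrow> complex multiset" where
  "inner_roots p = filter_mset (\<lambda>z. norm z < 1) (proots p)"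

definition inner_part :: "complex poly \<Rightarrow> complex poly" where
  "inner_part p = (\<Prod>z\<in>#inner_roots p. [:- z, 1:])"

lemma degree_prod_linear_factors: "degree (\<Prod>z\<in>#M. [:- z, 1 :: complex:]) = size M"
  and prod_linear_factors_nonzero: "(\<Prod>z\<in>#M. [:- z, 1 :: complex:]) \<noteq> 0"
proof -
  show nz: "(\<Prod>z\<in>#M. [:- z, 1 :: complex:]) \<noteq> 0" for M
    by auto
  show "degree (\<Prod>z\<in>#M. [:- z, 1 :: complex:]) = size M"
  proof (induction M)
    case (add z M)
    have "degree ([:- z, 1:] * (\<Prod>z\<in>#M. [:- z, 1:])) = 1 + degree (\<Prod>z\<in>#M. [:- z, 1:])"
      using nz[of M] by (subst degree_mult_eq) simp_all
    with add show ?case by (simp del: mult_pCons_left)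
  qed simp
qed

lemma poly_prod_linear_factors_eq_0_iff:
  "poly (\<Prod>z\<in>#M. [:- z, 1 :: complex:]) w = 0 \<longleftrightarrow> w \<in># M"
  by (induction M) auto

lemma inner_part_nonzero [simp]: "inner_part p \<noteq> 0"
  unfolding inner_part_def by (rule prod_linear_factors_nonzero)

lemma degree_inner_part: "degree (inner_part p) = size (inner_roots p)"
  by (simp add: inner_part_def degree_prod_linear_factors)

lemma norm_root_inner_part: "poly (inner_part p) z = 0 \<Longrightarrow> norm z < 1"
  by (simp add: inner_part_def poly_prod_linear_factors_eq_0_iff inner_roots_def)

lemma inner_roots_mult:
  "p \<noteq> 0 \<Longrightarrow> q \<noteq> 0 \<Longrightarrow> inner_roots (p * q) = inner_roots p + inner_roots q"
  by (simp add: inner_roots_def proots_mult)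

lemma inner_part_dvd_mono:
  assumes "p dvd q" "q \<noteq> 0"
  shows "inner_part p dvd inner_part q"
proof -
  obtain s where "q = p * s" "p \<noteq> 0" "s \<noteq> 0"
    using assms by auto
  then have "inner_part q = inner_part p * inner_part s"
    by (simp add: inner_part_def inner_roots_mult)
  then show ?thesis by simp
qed

lemma inner_outer_factorization:
  assumes "p \<noteq> 0"
  obtains p' where "p = inner_part p * p'" "\<And>z. norm z < 1 \<Longrightarrow> poly p' z \<noteq> 0"
proof
  define Z where "Z = filter_mset (\<lambda>z. \<not> norm z < 1) (proots p)"
  define p' where "p' = Polynomial.smult (lead_coeff p) (\<Prod>z\<in>#Z. [:- z, 1:])"
  have "proots p = inner_roots p + Z"
    by (simp add: inner_roots_def Z_def)
  then show "p = inner_part p * p'"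
    using complex_poly_decompose_multiset[of p] by (simp add: p'_def inner_part_def)
  show "poly p' z \<noteq> 0" if "norm z < 1" for z
    using that assms by (auto simp: p'_def poly_prod_linear_factors_eq_0_iff Z_def)
qed

lemma inner_part_dvd: "inner_part p dvd p"
proof (cases "p = 0")
  case False
  from inner_outer_factorization[OF this] show ?thesis
    by (metis dvd_triv_left)
qed simp

lemma inner_roots_eq_empty:
  assumes "\<And>z. norm z < 1 \<Longrightarrow> poly p z \<noteq> 0"
  shows "inner_roots p = {#}"
proof -
  have "p \<noteq> 0" using assms[of 0] by auto
  with assms show ?thesis
    by (auto simp: inner_roots_def filter_mset_eq_conv set_count_proots)
qed

lemma size_inner_roots_eq_degree:
  assumes "p \<noteq> 0" "\<And>z. norm z \<ge> 1 \<Longrightarrow> poly p z \<noteq> 0"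
  shows "size (inner_roots p) = degree p"
proof -
  have "inner_roots p = proots p"
    using assms by (force simp: inner_roots_def filter_mset_eq_conv set_count_proots not_less)
  then show ?thesis by (simp add: size_proots_complex)
qed

lemma to_fract_rat_num: "to_fract (rat_num f) = f * to_fract (rat_den f)"
proof -
  have "f = to_fract (rat_num f) / to_fract (rat_den f)"
    using Fract_quot_of_fract[of f]
    by (simp add: rat_num_def rat_den_def Fract_conv_to_fract del: Fract_quot_of_fract)
  moreover have "to_fract (rat_den f) \<noteq> 0"
    by (simp add: rat_den_def)
  ultimately show ?thesis by (simp add: field_simps)
qed

lemma rat_den_nonzero [simp]: "rat_den f \<noteq> 0"
  by (simp add: rat_den_def)

lemma to_fract_power: "to_fract (p ^ n) = to_fract p ^ n"
  by (induction n) simp_all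

text \<open>
  After clearing denominators both sides are products of polynomials, and zeros in the open disk
  are counted additively. The factors \<open>t - t\<^sub>i\<close> and the plus factor contribute none. All zeros and
  poles of the minus factor lie in the disk, and there are equally many of them because it has
  neither a zero nor a pole at infinity. What remains is the power of \<open>t\<close>.
\<close>
lemma size_inner_roots_of_representation:
  fixes p q :: "complex poly" and \<beta> :: "nat \<Rightarrow> nat"
  assumes "p \<noteq> 0" "q \<noteq> 0" and circle: "\<And>i. i \<in> I \<Longrightarrow> norm (t i) = 1"
    and rep: "Fract p q = (\<Prod>i\<in>I. to_fract [:- t i, 1:] ^ \<beta> i) * to_fract [:0, 1:] powi k * f * g"
    and minus: "minus_factor f" and plus: "plus_factor g" and "k \<ge> 0"
  shows "size (inner_roots p) = size (inner_roots q) + nat k"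
proof -
  define T where "T = (\<Prod>i\<in>I. [:- t i, 1:] ^ \<beta> i)"
  define X where "X = [:0, 1 :: complex:] ^ nat k"
  have T: "to_fract T = (\<Prod>i\<in>I. to_fract [:- t i, 1:] ^ \<beta> i)"
    unfolding T_def
    by (induction I rule: infinite_finite_induct) (simp_all add: to_fract_power)
  have X: "to_fract X = to_fract [:0, 1:] powi k"
    using \<open>k \<ge> 0\<close> by (simp add: X_def power_int_def to_fract_power)
  have "to_fract p = to_fract q * to_fract T * to_fract X * f * g"
    using rep \<open>q \<noteq> 0\<close> unfolding T X by (simp add: Fract_conv_to_fract field_simps)
  then have "to_fract (p * (rat_den f * rat_den g)) = to_fract (q * (T * (X * (rat_num f * rat_num g))))"
    by (simp add: to_fract_rat_num)
  then have eq: "p * (rat_den f * rat_den g) = q * (T * (X * (rat_num f * rat_num g)))"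
    by (simp only: to_fract_eq_iff)
  have nz: "rat_num f \<noteq> 0" "rat_num g \<noteq> 0"
    using minus[unfolded minus_factor_def rat_zero_at_def, THEN conjunct1, rule_format, of 1]
      plus[unfolded plus_factor_def rat_zero_at_def, rule_format, of 0] by auto
  have T_nz: "poly T z \<noteq> 0" if "norm z < 1" for z
  proof (cases "finite I")
    case True
    then show ?thesis using circle that by (auto simp: T_def poly_prod poly_power)
  qed (simp add: T_def)
  from T_nz[of 0] have "T \<noteq> 0" by auto
  have "X \<noteq> 0" by (simp add: X_def)
  have "degree X = nat k" by (simp add: X_def degree_power_eq)
  moreover have "size (inner_roots X) = degree X"
    using \<open>X \<noteq> 0\<close> by (rule size_inner_roots_eq_degree) (auto simp: X_def poly_power)
  moreover have "size (inner_roots (rat_num f)) = degree (rat_num f)"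
    "size (inner_roots (rat_den f)) = degree (rat_den f)"
    using minus nz by (auto intro!: size_inner_roots_eq_degree
        simp: minus_factor_def rat_zero_at_def rat_pole_at_def)
  moreover have "degree (rat_num f) = degree (rat_den f)"
    using minus by (auto simp: minus_factor_def rat_zero_at_infinity_def rat_pole_at_infinity_def)
  moreover have "inner_roots T = {#}" "inner_roots (rat_num g) = {#}" "inner_roots (rat_den g) = {#}"
    using plus T_nz by (auto intro!: inner_roots_eq_empty
        simp: plus_factor_def rat_zero_at_def rat_pole_at_def)
  moreover have "inner_roots (p * (rat_den f * rat_den g)) =
      inner_roots p + (inner_roots (rat_den f) + inner_roots (rat_den g))"
    using assms by (simp add: inner_roots_mult)
  moreover have "inner_roots (q * (T * (X * (rat_num f * rat_num g)))) = inner_roots q +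
      (inner_roots T + (inner_roots X + (inner_roots (rat_num f) + inner_roots (rat_num g))))"
    using assms nz \<open>T \<noteq> 0\<close> \<open>X \<noteq> 0\<close> by (simp add: inner_roots_mult)
  ultimately show ?thesis
    using arg_cong[OF eq, of "\<lambda>s. size (inner_roots s)"] by simp
qed

text \<open>
  \<^const>\<open>rat_eval\<close> evaluates the reduced fraction, whose denominator cannot vanish where \<open>q\<close> does not.
\<close>
lemma rat_eval_Fract:
  assumes "poly q z \<noteq> 0"
  shows "rat_eval (Fract s q) z = poly s z / poly q z"
proof -
  let ?f = "Fract s q"
  have "q \<noteq> 0" using assms by auto
  have "to_fract (rat_num ?f * q) = to_fract (s * rat_den ?f)"
    using to_fract_rat_num[of ?f] \<open>q \<noteq> 0\<close> by (simp add: Fract_conv_to_fract field_simps)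
  then have eq: "rat_num ?f * q = s * rat_den ?f"
    by (simp only: to_fract_eq_iff)
  then have eqz: "poly (rat_num ?f) z * poly q z = poly s z * poly (rat_den ?f) z"
    by (metis poly_mult)
  have "poly (rat_den ?f) z \<noteq> 0"
  proof
    assume den: "poly (rat_den ?f) z = 0"
    then have "poly (rat_num ?f) z = 0" using eqz assms by simp
    with den have "[:- z, 1:] dvd rat_num ?f" "[:- z, 1:] dvd rat_den ?f"
      by (simp_all add: poly_eq_0_iff_dvd)
    moreover have "coprime (rat_num ?f) (rat_den ?f)"
      by (simp add: rat_num_def rat_den_def coprime_quot_of_fract)
    ultimately have "is_unit [:- z, 1:]"
      by (metis coprime_common_divisor)
    then show False by (simp add: is_unit_pCons_iff)
  qed
  then show ?thesis using eqz assms by (simp add: rat_eval_def field_simps)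
qed

section \<open>A polynomial row vector with prescribed divisibilities\<close>

lemma sum_block_index:
  fixes f :: "nat \<Rightarrow> 'a :: comm_monoid_add"
  shows "(\<Sum>s<n * l. f s) = (\<Sum>a<n. \<Sum>k<l. f (a * l + k))"
proof -
  have "(\<Sum>s = a * l..<a * l + l. f s) = (\<Sum>k<l. f (a * l + k))" for a
    by (simp add: sum.atLeastLessThan_shift_0 atLeast0LessThan)
  then show ?thesis by (simp flip: sum.nat_group)
qed

lemma block_index_less: "a < n \<Longrightarrow> k < l \<Longrightarrow> a * l + k < n * (l :: nat)"
  using mult_le_mono1[of "Suc a" n l] by simp

text \<open>
  Divisibility by \<open>Q j\<close> means that the remainder modulo \<open>Q j\<close> vanishes, and the remainder depends
  linearly on the coefficients of \<open>v\<close>. There are \<open>N l\<close> unknown coefficients, and at most \<open>l\<close> equations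
  for each \<open>j\<close> except the trivial \<open>j0\<close>. The equations are padded to a square system, so that the
  zero rows belonging to \<open>j0\<close> force a zero determinant and hence a nontrivial solution.
\<close>
lemma exists_row_with_divisibilities:
  fixes G :: "nat \<Rightarrow> nat \<Rightarrow> complex poly" and Q :: "nat \<Rightarrow> complex poly"
  assumes "l > 0" and Q_nz: "\<And>j. j < N \<Longrightarrow> Q j \<noteq> 0"
    and deg: "\<And>j. j < N \<Longrightarrow> degree (Q j) \<le> l"
    and "j0 < N" "Q j0 = 1"
  obtains v where "\<exists>a<N. v a \<noteq> 0" "\<And>a. a < N \<Longrightarrow> degree (v a) < l"
    "\<And>j. j < N \<Longrightarrow> Q j dvd (\<Sum>a<N. v a * G a j)"
proof -
  define W where "W = mat (N * l) (N * l) (\<lambda>(r, s).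
    coeff ((monom 1 (s mod l) * G (s div l) (r div l)) mod Q (r div l)) (r mod l))"
  have W: "W \<in> carrier_mat (N * l) (N * l)" by (simp add: W_def)
  have j0: "j0 * l < N * l" using \<open>j0 < N\<close> \<open>l > 0\<close> by simp
  have "W = mat\<^sub>r (N * l) (N * l) (\<lambda>r. if r = j0 * l then 0\<^sub>v (N * l) else row W r)"
    using j0 \<open>l > 0\<close> \<open>Q j0 = 1\<close> by (intro eq_matI) (auto simp: W_def)
  also have "det \<dots> = 0"
    by (rule det_row_0[OF j0]) (simp add: W_def)
  finally have "det W = 0" .
  then obtain x where x: "x \<in> carrier_vec (N * l)" "x \<noteq> 0\<^sub>v (N * l)" "W *\<^sub>v x = 0\<^sub>v (N * l)"
    using det_0_iff_vec_prod_zero[OF W] by auto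
  define v where "v a = (\<Sum>k<l. monom (x $ (a * l + k)) k)" for a
  note index = block_index_less
  have coeff_v: "coeff (v a) k = x $ (a * l + k)" if "k < l" for a k
    using that by (simp add: v_def coeff_sum if_distrib cong: if_cong)
  show ?thesis
  proof (rule that[of v])
    obtain s where s: "s < N * l" "x $ s \<noteq> 0"
      using x by (metis carrier_vecD eq_vecI index_zero_vec)
    have "s div l < N" "s mod l < l"
      using s \<open>l > 0\<close> by (auto simp: less_mult_imp_div_less)
    moreover have "coeff (v (s div l)) (s mod l) \<noteq> 0"
      using s \<open>l > 0\<close> by (simp add: coeff_v)
    ultimately show "\<exists>a<N. v a \<noteq> 0" by (metis coeff_0)
    show "degree (v a) < l" for a
    proof -
      have "degree (v a) \<le> l - 1"
        unfolding v_def by (rule degree_sum_le) (auto intro: order.trans[OF degree_monom_le])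
      then show ?thesis using \<open>l > 0\<close> by simp
    qed
    fix j assume j: "j < N"
    have "coeff ((\<Sum>a<N. v a * G a j) mod Q j) i = 0" if i: "i < l" for i
    proof -
      have r: "j * l + i < N * l" by (rule index[OF j i])
      have mod_sum: "(\<Sum>b\<in>B. h b) mod Q j = (\<Sum>b\<in>B. h b mod Q j)" if "finite B" for h :: "nat \<Rightarrow> complex poly" and B
        using that by (induction B) (simp_all add: poly_mod_add_left)
      have "v a * G a j mod Q j = (\<Sum>k<l. Polynomial.smult (x $ (a * l + k)) ((monom 1 k * G a j) mod Q j))" for a
      proof -
        have "v a * G a j = (\<Sum>k<l. Polynomial.smult (x $ (a * l + k)) (monom 1 k * G a j))"
          unfolding v_def sum_distrib_right
          by (simp add: smult_monom flip: mult_smult_left)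
        then show ?thesis by (simp add: mod_sum mod_smult_left)
      qed
      then have "coeff ((\<Sum>a<N. v a * G a j) mod Q j) i =
          (\<Sum>a<N. \<Sum>k<l. x $ (a * l + k) * coeff ((monom 1 k * G a j) mod Q j) i)"
        by (simp add: mod_sum coeff_sum)
      also have "\<dots> = (\<Sum>a<N. \<Sum>k<l. W $$ (j * l + i, a * l + k) * x $ (a * l + k))"
        using r i by (intro sum.cong) (auto simp: W_def index)
      also have "\<dots> = (\<Sum>s<N * l. W $$ (j * l + i, s) * x $ s)"
        by (simp add: sum_block_index)
      also have "\<dots> = (W *\<^sub>v x) $ (j * l + i)"
        using r x(1) W by (simp add: scalar_prod_def atLeast0LessThan)
      also have "\<dots> = 0" using x r by simp
      finally show ?thesis .
    qed
    moreover have "coeff ((\<Sum>a<N. v a * G a j) mod Q j) i = 0" if "\<not> i < l" for i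
      using that Q_nz[OF j] deg[OF j] degree_mod_less[of "Q j" "\<Sum>a<N. v a * G a j"]
      by (auto intro: coeff_eq_0)
    ultimately have "(\<Sum>a<N. v a * G a j) mod Q j = 0"
      by (intro poly_eqI) (metis coeff_0)
    then show "Q j dvd (\<Sum>a<N. v a * G a j)" by (simp add: dvd_eq_mod_eq_0)
  qed
qed

section \<open>Expansion at infinity of a rational function with poles inside the disk\<close>

lemma poly_nonzero_on_larger_disk:
  fixes p :: "complex poly"
  assumes "\<And>z. norm z \<le> 1 \<Longrightarrow> poly p z \<noteq> 0"
  obtains R where "R > 1" "\<And>z. norm z < R \<Longrightarrow> poly p z \<noteq> 0"
proof -
  have "p \<noteq> 0" using assms[of 0] by auto
  define R where "R = Min (insert 2 (norm ` {z. poly p z = 0}))"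
  have fin: "finite (insert 2 (norm ` {z. poly p z = 0}))"
    using poly_roots_finite[OF \<open>p \<noteq> 0\<close>] by simp
  have "R > 1"
    unfolding R_def using fin assms by (subst Min_gr_iff) (auto simp: not_le[symmetric])
  moreover have "poly p z \<noteq> 0" if "norm z < R" for z
  proof
    assume "poly p z = 0"
    then have "R \<le> norm z" unfolding R_def using fin by (intro Min_le) auto
    with that show False by simp
  qed
  ultimately show ?thesis by (rule that)
qed

lemma poly_eq_power_mult_reflect:
  fixes p :: "complex poly"
  assumes "z \<noteq> 0"
  shows "poly p z = z ^ degree p * poly (reflect_poly p) (1 / z)"
  using poly_reflect_poly_nz[of "1 / z" p] assms by (simp add: field_simps)

text \<open>
  With \<open>w = 1 / z\<close> the proper fraction \<open>u / d\<close> becomes \<open>w\<close> times a function that is holomorphic on a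
  disk of radius greater than \<open>1\<close>: the reflected denominator has its zeros outside the closed
  unit disk. The Taylor coefficients of that function decay geometrically, at a rate that depends
  on \<open>d\<close> alone, so that the same \<open>\<rho>\<close> serves all entries of a row.
\<close>
lemma expansion_at_infinity:
  fixes d :: "complex poly"
  assumes "d \<noteq> 0" and roots: "\<And>z. poly d z = 0 \<Longrightarrow> norm z < 1"
  obtains \<rho> where "0 < \<rho>" "\<rho> < 1"
    "\<And>u. degree u < degree d \<Longrightarrow> \<exists>c C. \<forall>n z. norm z = 1 \<longrightarrow>
       norm (poly u z / poly d z - (\<Sum>k<n. c k / z ^ Suc k)) \<le> C * \<rho> ^ n"
proof -
  have "poly (reflect_poly d) w \<noteq> 0" if "norm w \<le> 1" for w
  proof (cases "w = 0")
    case False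
    then have "norm (1 / w) \<ge> 1" using that by (simp add: norm_divide)
    with roots[of "1 / w"] have "poly d (1 / w) \<noteq> 0" by fastforce
    then show ?thesis using poly_reflect_poly_nz[of w d] False by (simp add: inverse_eq_divide)
  qed (use \<open>d \<noteq> 0\<close> in \<open>simp\<close>)
  then obtain R where R: "R > 1" "\<And>w. norm w < R \<Longrightarrow> poly (reflect_poly d) w \<noteq> 0"
    using poly_nonzero_on_larger_disk by blast
  define s where "s = (1 + R) / 2"
  have s: "1 < s" "s < R" using R(1) by (simp_all add: s_def)
  have expansion: "\<exists>c C. \<forall>n z. norm z = 1 \<longrightarrow>
       norm (poly u z / poly d z - (\<Sum>k<n. c k / z ^ Suc k)) \<le> C * (1 / s) ^ n"
    if deg: "degree u < degree d" for u
  proof -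
    define g where "g w = w ^ (degree d - 1 - degree u) * poly (reflect_poly u) w
      / poly (reflect_poly d) w" for w
    define c where "c n = (deriv ^^ n) g 0 / fact n" for n
    have "g holomorphic_on ball 0 R"
      unfolding g_def using R by (auto intro!: holomorphic_intros)
    then have sums: "(\<lambda>n. c n * w ^ n) sums g w" if "norm w < R" for w
      using holomorphic_power_series[of g 0 R w] that by (simp add: c_def)
    \<comment> \<open>The exponent \<open>deg d - 1 - deg u\<close> in \<open>g\<close> is what remains of \<open>w\<close> to the power \<open>deg d - deg u\<close> once one
      factor \<open>w\<close> has been split off; it is a natural number as \<open>u / d\<close> is proper.\<close>
    have g: "poly u z / poly d z = (1 / z) * g (1 / z)" if "norm z = 1" for z
    proof -
      have "z \<noteq> 0" using that by auto
      have "z ^ degree d = z * z ^ (degree d - 1 - degree u) * z ^ degree u"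
        using deg by (simp flip: power_Suc power_add)
      then show ?thesis
        using \<open>z \<noteq> 0\<close> by (simp add: g_def poly_eq_power_mult_reflect[of z u]
            poly_eq_power_mult_reflect[of z d] power_divide field_simps)
    qed
    have "summable (\<lambda>n. c n * of_real s ^ n)"
      using sums[of "of_real s"] s by (simp add: sums_iff)
    then have "Bseq (\<lambda>n. c n * of_real s ^ n)"
      by (intro convergent_imp_Bseq) (auto intro: summable_LIMSEQ_zero convergentI)
    then obtain K where K: "\<And>n. norm (c n * of_real s ^ n) \<le> K"
      by (auto simp: Bseq_def)
    have c: "norm (c n) \<le> K * (1 / s) ^ n" for n
      using K[of n] s by (simp add: norm_mult norm_power power_divide field_simps)
    have geom: "(\<lambda>k. K * (1 / s) ^ n * (1 / s) ^ k) sums (K * (1 / s) ^ n * (1 / (1 - 1 / s)))" for n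
      using s by (intro sums_mult geometric_sums) auto
    have "norm (poly u z / poly d z - (\<Sum>k<n. c k / z ^ Suc k)) \<le> K / (1 - 1 / s) * (1 / s) ^ n"
      if z: "norm z = 1" for n z
    proof -
      have nz: "norm (1 / z) = 1" using z by (simp add: norm_divide)
      have "poly u z / poly d z - (\<Sum>k<n. c k / z ^ Suc k)
          = (1 / z) * (g (1 / z) - (\<Sum>k<n. c k * (1 / z) ^ k))"
        by (simp add: g[OF z] right_diff_distrib sum_distrib_left power_divide)
      then have "norm (poly u z / poly d z - (\<Sum>k<n. c k / z ^ Suc k))
          = norm (g (1 / z) - (\<Sum>k<n. c k * (1 / z) ^ k))"
        by (simp only: norm_mult nz mult_1)
      also have "g (1 / z) - (\<Sum>k<n. c k * (1 / z) ^ k) = (\<Sum>k. c (k + n) * (1 / z) ^ (k + n))"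
        using sums[of "1 / z"] suminf_minus_initial_segment[of "\<lambda>k. c k * (1 / z) ^ k" n] nz R(1)
        by (simp add: sums_iff)
      also have "norm \<dots> \<le> (\<Sum>k. K * (1 / s) ^ n * (1 / s) ^ k)"
      proof (rule norm_suminf_le)
        show "norm (c (k + n) * (1 / z) ^ (k + n)) \<le> K * (1 / s) ^ n * (1 / s) ^ k" for k
          using c[of "k + n"] nz by (simp only: norm_mult norm_power) (simp add: power_add mult_ac)
      qed (use geom in \<open>auto simp: sums_iff\<close>)
      also have "\<dots> = K / (1 - 1 / s) * (1 / s) ^ n"
        using geom[of n] by (simp add: sums_iff)
      finally show ?thesis .
    qed
    then show ?thesis by blast
  qed
  show ?thesis
    by (rule that[of "1 / s"]) (use s expansion in auto)
qed

section \<open>Fourier coefficients\<close>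

lemma has_integral_circle_moment_zero:
  assumes "g holomorphic_on ball 0 R" "1 < R"
  shows "((\<lambda>\<theta>. g (cis \<theta>) * cis \<theta> ^ Suc j) has_integral 0) {0..2 * pi}"
proof -
  have "((\<lambda>z. g z * z ^ j) has_contour_integral 0) (circlepath 0 1)"
    using assms by (intro Cauchy_theorem_disc_simple[of _ 0 R] holomorphic_intros) auto
  then have "((\<lambda>\<theta>. g (cis \<theta>) * cis \<theta> ^ j * \<i> * cis \<theta>) has_integral 0) {0..2 * pi}"
    unfolding circlepath_def by (subst (asm) has_contour_integral_part_circlepath_iff) simp_all
  from has_integral_mult_right[OF this, of "- \<i>"] show ?thesis
    by (simp add: mult_ac)
qed

text \<open>
  If \<open>y\<close> were equal to its truncated expansion, the double sum would be the Fourier coefficient of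
  \<open>\<Sum>a. y a * f a = g\<close> at a negative index, which is zero by Cauchy's theorem. The actual value
  therefore comes from the truncation error alone. Arguing with the truncated expansion keeps the
  sum finite, so that it commutes with the integral.
\<close>
lemma fourier_truncated_annihilation:
  fixes f y :: "'a \<Rightarrow> complex \<Rightarrow> complex"
  assumes "finite I"
    and cont: "\<And>a. a \<in> I \<Longrightarrow> continuous_on (sphere 0 1) (f a)"
    and bound: "\<And>a z. a \<in> I \<Longrightarrow> norm z = 1 \<Longrightarrow> norm (f a z) \<le> B"
    and approx: "\<And>a z. a \<in> I \<Longrightarrow> norm z = 1 \<Longrightarrow> norm (y a z - (\<Sum>k<n. c a k / z ^ Suc k)) \<le> E"
    and g: "g holomorphic_on ball 0 R" "1 < R"
    and annih: "\<And>z. norm z = 1 \<Longrightarrow> (\<Sum>a\<in>I. y a z * f a z) = g z"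
  shows "norm (\<Sum>a\<in>I. \<Sum>k<n. c a k * fourier_coeff (f a) (int k - int j)) \<le> real (card I) * (E * B)"
proof -
  define F where "F a k \<theta> = f a (cis \<theta>) * (cis \<theta> ^ Suc j / cis \<theta> ^ Suc k)" for a k \<theta>
  define h where "h \<theta> = (\<Sum>a\<in>I. \<Sum>k<n. c a k * F a k \<theta>)" for \<theta>
  have coeff: "fourier_coeff (f a) (int k - int j) = 1 / (2 * of_real pi) * integral {0..2 * pi} (F a k)" for a k
  proof -
    have "exp (- (\<i> * of_int (int k - int j) * of_real \<theta>)) = cis \<theta> ^ Suc j / cis \<theta> ^ Suc k" for \<theta>
    proof -
      have "- (\<i> * of_int (int k - int j) * of_real \<theta>) = \<i> * of_real (real (Suc j) * \<theta> - real (Suc k) * \<theta>)"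
        by (simp add: algebra_simps)
      then show ?thesis
        unfolding Complex.DeMoivre cis_divide by (simp only: cis_conv_exp)
    qed
    then have "fourier_coeff (f a) (int k - int j) = 1 / (2 * of_real pi)
        * integral {0..2 * pi} (\<lambda>\<theta>. f a (cis \<theta>) * (cis \<theta> ^ Suc j / cis \<theta> ^ Suc k))"
      unfolding fourier_coeff_def cis_conv_exp by (simp only:)
    then show ?thesis unfolding F_def .
  qed
  have int_F: "(F a k has_integral integral {0..2 * pi} (F a k)) {0..2 * pi}" if "a \<in> I" for a k
  proof -
    have "continuous_on {0..2 * pi} (\<lambda>\<theta>. f a (cis \<theta>))"
      by (rule continuous_on_compose2[OF cont[OF that]]) (auto intro!: continuous_intros)
    then have "continuous_on {0..2 * pi} (F a k)"
      unfolding F_def by (auto intro!: continuous_intros)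
    then show ?thesis by (intro integrable_integral integrable_continuous_interval)
  qed
  have int_h: "(h has_integral (\<Sum>a\<in>I. \<Sum>k<n. c a k * integral {0..2 * pi} (F a k))) {0..2 * pi}"
    unfolding h_def using \<open>finite I\<close> by (intro has_integral_sum has_integral_mult_right int_F) auto
  have "((\<lambda>\<theta>. h \<theta> - g (cis \<theta>) * cis \<theta> ^ Suc j) has_integral
      (\<Sum>a\<in>I. \<Sum>k<n. c a k * integral {0..2 * pi} (F a k)) - 0) {0..2 * pi}"
    by (intro has_integral_diff int_h has_integral_circle_moment_zero[OF g])
  moreover have "norm (h \<theta> - g (cis \<theta>) * cis \<theta> ^ Suc j) \<le> real (card I) * (E * B)" for \<theta>
  proof -
    define e where "e a = y a (cis \<theta>) - (\<Sum>k<n. c a k / cis \<theta> ^ Suc k)" for a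
    have "h \<theta> = (\<Sum>a\<in>I. (\<Sum>k<n. c a k / cis \<theta> ^ Suc k) * f a (cis \<theta>)) * cis \<theta> ^ Suc j"
      unfolding h_def F_def sum_distrib_right by (intro sum.cong) (simp_all add: mult_ac)
    moreover have "g (cis \<theta>) * cis \<theta> ^ Suc j = (\<Sum>a\<in>I. y a (cis \<theta>) * f a (cis \<theta>)) * cis \<theta> ^ Suc j"
      by (simp add: annih)
    ultimately have "h \<theta> - g (cis \<theta>) * cis \<theta> ^ Suc j = - (\<Sum>a\<in>I. e a * f a (cis \<theta>)) * cis \<theta> ^ Suc j"
      by (simp add: e_def algebra_simps sum_subtractf)
    then have "norm (h \<theta> - g (cis \<theta>) * cis \<theta> ^ Suc j) = norm (\<Sum>a\<in>I. e a * f a (cis \<theta>))"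
      by (simp only: norm_mult norm_power norm_cis norm_minus_cancel) simp
    also have "\<dots> \<le> (\<Sum>a\<in>I. E * B)"
    proof (rule sum_norm_le)
      fix a assume "a \<in> I"
      then have "norm (e a) \<le> E" "norm (f a (cis \<theta>)) \<le> B"
        using approx[of a "cis \<theta>"] bound by (auto simp: e_def)
      then show "norm (e a * f a (cis \<theta>)) \<le> E * B"
        unfolding norm_mult by (intro mult_mono) (auto intro: order.trans[OF norm_ge_zero])
    qed
    finally show ?thesis by simp
  qed
  moreover have "0 \<le> real (card I) * (E * B)"
    using calculation(2) order.trans[OF norm_ge_zero] by blast
  ultimately have "norm (\<Sum>a\<in>I. \<Sum>k<n. c a k * integral {0..2 * pi} (F a k))
      \<le> real (card I) * (E * B) * (2 * pi)"
    using has_integral_bound[of "real (card I) * (E * B)" _ _ 0 "2 * pi"] by fastforce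
  moreover have "(\<Sum>a\<in>I. \<Sum>k<n. c a k * fourier_coeff (f a) (int k - int j)) =
      1 / (2 * of_real pi) * (\<Sum>a\<in>I. \<Sum>k<n. c a k * integral {0..2 * pi} (F a k))"
    by (simp add: coeff sum_distrib_left mult_ac)
  ultimately show ?thesis
    by (simp only: norm_mult norm_divide) (simp add: pos_divide_le_eq)
qed

section \<open>Condition numbers\<close>

lemma euclidean_norm_eq_L2_set: "euclidean_norm v = L2_set (\<lambda>i. norm (v $ i)) {..<dim_vec v}"
  by (simp add: euclidean_norm_def L2_set_def)

lemma norm_entry_le_euclidean_norm: "i < dim_vec v \<Longrightarrow> norm (v $ i) \<le> euclidean_norm v"
  unfolding euclidean_norm_eq_L2_set by (rule member_le_L2_set) auto

lemma norm_entry_le_spectral_norm: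
  assumes M: "M \<in> carrier_mat m n" and "i < m" "j < n"
  shows "norm (M $$ (i, j)) \<le> spectral_norm M"
proof -
  let ?U = "{v \<in> carrier_vec (dim_col M). euclidean_norm v \<le> 1}"
  have "euclidean_norm (M *\<^sub>v v) \<le> (\<Sum>i<m. \<Sum>j<n. norm (M $$ (i, j)))" if "v \<in> ?U" for v
  proof -
    have v: "v \<in> carrier_vec n" "euclidean_norm v \<le> 1" using that M by auto
    have "norm ((M *\<^sub>v v) $ i) \<le> (\<Sum>j<n. norm (M $$ (i, j)))" if "i < m" for i
    proof -
      have "(M *\<^sub>v v) $ i = (\<Sum>j<n. M $$ (i, j) * v $ j)"
        using M v that by (simp add: scalar_prod_def atLeast0LessThan)
      also have "norm \<dots> \<le> (\<Sum>j<n. norm (M $$ (i, j)))"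
      proof (rule sum_norm_le)
        fix j assume "j \<in> {..<n}"
        then have "norm (v $ j) \<le> 1" using norm_entry_le_euclidean_norm[of j v] v by auto
        then show "norm (M $$ (i, j) * v $ j) \<le> norm (M $$ (i, j))"
          by (simp add: norm_mult mult_left_le)
      qed
      finally show ?thesis .
    qed
    moreover have "euclidean_norm (M *\<^sub>v v) \<le> (\<Sum>i<m. norm ((M *\<^sub>v v) $ i))"
      using L2_set_le_sum[of "{..<m}" "\<lambda>i. norm ((M *\<^sub>v v) $ i)"] M
      by (simp add: euclidean_norm_eq_L2_set)
    ultimately show ?thesis by (smt (verit) lessThan_iff sum_mono)
  qed
  then have bdd: "bdd_above ((\<lambda>v. euclidean_norm (M *\<^sub>v v)) ` ?U)"
    by (intro bdd_aboveI2)
  have "(\<Sum>i<n. (norm (unit_vec n j $ i :: complex))\<^sup>2) = (\<Sum>i<n. if i = j then 1 else 0)"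
    using \<open>j < n\<close> by (intro sum.cong) auto
  then have "euclidean_norm (unit_vec n j) = 1"
    using \<open>j < n\<close> by (simp add: euclidean_norm_def)
  then have unit: "unit_vec n j \<in> ?U" using M by auto
  have "M $$ (i, j) = (M *\<^sub>v unit_vec n j) $ i"
    using assms by simp
  also have "norm \<dots> \<le> euclidean_norm (M *\<^sub>v unit_vec n j)"
    using assms by (intro norm_entry_le_euclidean_norm) simp
  also have "\<dots> \<le> spectral_norm M"
    unfolding spectral_norm_def by (rule cSUP_upper[OF unit bdd])
  finally show ?thesis .
qed

lemma mat_inverse_mult_entries:
  assumes M: "M \<in> carrier_mat d d" and inv: "mat_inverse M = Some M'" and "i < d" "k < d"
  shows "(\<Sum>l<d. M $$ (i, l) * M' $$ (l, k)) = (if i = k then 1 else 0)"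
proof -
  have M': "M * M' = 1\<^sub>m d" "M' \<in> carrier_mat d d"
    using mat_inverse(2)[OF M inv] by auto
  have "(M * M') $$ (i, k) = (\<Sum>l<d. M $$ (i, l) * M' $$ (l, k))"
    using M M'(2) assms(3,4) by (simp add: scalar_prod_def atLeast0LessThan)
  then show ?thesis using M' assms(3,4) by simp
qed

text \<open>
  Writing \<open>y = (y M) M\<^sup>-\<^sup>1\<close> bounds each entry of \<open>y\<close> by \<open>d \<epsilon>\<close> times the norm of the inverse. Estimating
  entrywise loses the dimension as a factor, which is harmless against exponential growth.
\<close>
lemma condition_number_ge_if_left_almost_null:
  assumes M: "M \<in> carrier_mat d d" and "\<epsilon> > 0"
    and small: "\<And>l. l < d \<Longrightarrow> norm (\<Sum>i<d. y i * M $$ (i, l)) \<le> \<epsilon>"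
    and "m < d" "k < d" "l < d"
  shows "ereal (norm (M $$ (k, l)) * norm (y m) / (real d * \<epsilon>)) \<le> condition_number M"
proof (cases "mat_inverse M")
  case None
  then show ?thesis by (simp add: condition_number_def)
next
  case (Some M')
  have M': "M' \<in> carrier_mat d d" using mat_inverse(2)[OF M Some] by auto
  have "y m = (\<Sum>i<d. y i * (\<Sum>l<d. M $$ (i, l) * M' $$ (l, m)))"
    using \<open>m < d\<close> by (simp add: mat_inverse_mult_entries[OF M Some] if_distrib cong: if_cong)
  also have "\<dots> = (\<Sum>l<d. (\<Sum>i<d. y i * M $$ (i, l)) * M' $$ (l, m))"
    unfolding sum_distrib_left sum_distrib_right by (subst sum.swap) (simp add: mult_ac)
  also have "norm \<dots> \<le> (\<Sum>l<d. \<epsilon> * spectral_norm M')"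
  proof (rule sum_norm_le)
    fix l assume "l \<in> {..<d}"
    then show "norm ((\<Sum>i<d. y i * M $$ (i, l)) * M' $$ (l, m)) \<le> \<epsilon> * spectral_norm M'"
      unfolding norm_mult using M' \<open>\<epsilon> > 0\<close> \<open>m < d\<close>
      by (intro mult_mono small norm_entry_le_spectral_norm) auto
  qed
  finally have "norm (y m) \<le> spectral_norm M' * (real d * \<epsilon>)" by (simp add: mult_ac)
  then have "norm (y m) / (real d * \<epsilon>) \<le> spectral_norm M'"
    using \<open>\<epsilon> > 0\<close> \<open>m < d\<close> by (simp add: divide_le_eq)
  moreover have "norm (M $$ (k, l)) \<le> spectral_norm M"
    using M \<open>k < d\<close> \<open>l < d\<close> by (rule norm_entry_le_spectral_norm)
  ultimately have "norm (M $$ (k, l)) * (norm (y m) / (real d * \<epsilon>)) \<le> spectral_norm M * spectral_norm M'"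
    using \<open>\<epsilon> > 0\<close> by (intro mult_mono) (auto intro: order.trans[OF norm_ge_zero])
  then show ?thesis by (simp add: condition_number_def Some)
qed

text \<open>
  This crude bound serves for the finitely many \<open>n\<close> that are too small for the asymptotic estimate.
\<close>
lemma condition_number_ge_inverse_dim:
  assumes M: "M \<in> carrier_mat d d" and "d > 0"
  shows "ereal (1 / real d) \<le> condition_number M"
proof (cases "mat_inverse M")
  case None
  then show ?thesis by (simp add: condition_number_def)
next
  case (Some M')
  have M': "M' \<in> carrier_mat d d" using mat_inverse(2)[OF M Some] by auto
  have "1 = norm (\<Sum>l<d. M $$ (0, l) * M' $$ (l, 0))"
    using \<open>d > 0\<close> by (simp add: mat_inverse_mult_entries[OF M Some])
  also have "\<dots> \<le> (\<Sum>l<d. spectral_norm M * spectral_norm M')"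
    using M M' \<open>d > 0\<close> unfolding norm_mult
    by (intro sum_norm_le) (auto simp: norm_mult intro!: mult_mono
        intro: norm_entry_le_spectral_norm order.trans[OF norm_ge_zero norm_entry_le_spectral_norm])
  finally show ?thesis
    using \<open>d > 0\<close> by (simp add: condition_number_def Some field_simps)
qed

lemma condition_number_zero_matrix:
  assumes M: "M \<in> carrier_mat d d" and "d > 0" and zero: "\<And>i j. i < d \<Longrightarrow> j < d \<Longrightarrow> M $$ (i, j) = 0"
  shows "condition_number M = \<infinity>"
proof (cases "mat_inverse M")
  case None
  then show ?thesis by (simp add: condition_number_def)
next
  case (Some M')
  have "(\<Sum>l<d. M $$ (0, l) * M' $$ (l, 0)) = 1"
    using \<open>d > 0\<close> by (simp add: mat_inverse_mult_entries[OF M Some])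
  then show ?thesis using zero \<open>d > 0\<close> by simp
qed

section \<open>Exponential growth from an approximate left null vector\<close>

lemma block_toeplitz_carrier: "block_toeplitz N A n \<in> carrier_mat (n * N) (n * N)"
  by (simp add: block_toeplitz_def)

lemma block_toeplitz_entry:
  assumes "k < n" "j < n" "a < N" "b < N"
  shows "block_toeplitz N A n $$ (k * N + a, j * N + b)
    = fourier_coeff (rat_eval (A $$ (a, b))) (int k - int j)"
  using assms by (simp add: block_toeplitz_def block_index_less)

text \<open>
  With \<open>\<gamma> = - ln \<rho> / 2\<close>, half of the growth of \<open>\<rho>\<^sup>-\<^sup>n = exp (\<gamma> n) exp (\<gamma> n)\<close> is spent on absorbing the factor \<open>n\<close>.
\<close>
lemma geometric_beats_linear:
  assumes "0 < \<rho>" "\<rho> < 1" "K \<ge> 0" "n \<ge> 1"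
  shows "K * (- ln \<rho> / 2) * exp (- ln \<rho> / 2 * real n) \<le> K / (real n * \<rho> ^ n)"
proof -
  define \<gamma> where "\<gamma> = - ln \<rho> / 2"
  have "exp (\<gamma> * real n) * exp (\<gamma> * real n) = exp (real n * - ln \<rho>)"
    by (simp add: \<gamma>_def flip: exp_add)
  also have "\<dots> = 1 / \<rho> ^ n"
    unfolding exp_of_nat_mult using \<open>0 < \<rho>\<close> by (simp add: exp_minus power_divide inverse_eq_divide)
  finally have "1 / \<rho> ^ n = exp (\<gamma> * real n) * exp (\<gamma> * real n)" by simp
  moreover have "\<gamma> * real n \<le> exp (\<gamma> * real n)"
    using exp_ge_add_one_self[of "\<gamma> * real n"] by linarith
  ultimately have "\<gamma> * real n * exp (\<gamma> * real n) \<le> 1 / \<rho> ^ n"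
    by (simp add: mult_right_mono)
  then have "\<gamma> * exp (\<gamma> * real n) \<le> 1 / \<rho> ^ n / real n"
    using \<open>n \<ge> 1\<close> by (subst pos_le_divide_eq) (simp, simp only: mult_ac)
  then have "K * (\<gamma> * exp (\<gamma> * real n)) \<le> K * (1 / \<rho> ^ n / real n)"
    using \<open>K \<ge> 0\<close> by (rule mult_left_mono)
  then show ?thesis by (simp add: \<gamma>_def mult_ac)
qed

text \<open>
  Here \<open>Y = u / d\<close> is the annihilating row: on the unit circle, \<open>Y A = (u S) / (d q\<^sub>1 q\<^sub>2)\<close> reduces to a
  rational function with denominator \<open>q\<^sub>2\<close>, which is holomorphic beyond the closed disk.
\<close>
lemma condition_number_exponential_if_annihilated:
  fixes S :: "complex poly mat" and u :: "nat \<Rightarrow> complex poly"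
  assumes "N \<ge> 1" and S: "S \<in> carrier_mat N N"
    and A: "A = map_mat (\<lambda>s. Fract s q) S" and q: "q = q\<^sub>1 * q\<^sub>2"
    and q1: "\<And>z. norm z = 1 \<Longrightarrow> poly q\<^sub>1 z \<noteq> 0" and q2: "\<And>z. norm z \<le> 1 \<Longrightarrow> poly q\<^sub>2 z \<noteq> 0"
    and "d \<noteq> 0" and d: "\<And>z. poly d z = 0 \<Longrightarrow> norm z < 1"
    and deg: "\<And>a. a < N \<Longrightarrow> degree (u a) < degree d"
    and u_nz: "\<exists>a<N. u a \<noteq> 0"
    and dvd: "\<And>b. b < N \<Longrightarrow> d * q\<^sub>1 dvd (\<Sum>a<N. u a * S $$ (a, b))"
  shows "\<exists>c \<gamma>. c > 0 \<and> \<gamma> > 0 \<and>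
    (\<forall>n\<ge>1. condition_number (block_toeplitz N A n) \<ge> ereal (c * exp (\<gamma> * real n)))"
proof -
  define f where "f a b = rat_eval (A $$ (a, b))" for a b
  have d_circle: "poly d z \<noteq> 0" and q_circle: "poly q z \<noteq> 0" if "norm z = 1" for z
    using d[of z] q1[of z] q2[of z] that by (auto simp: q)
  have f: "f a b z = poly (S $$ (a, b)) z / poly q z" if "a < N" "b < N" "norm z = 1" for a b z
    using that S by (simp add: f_def A rat_eval_Fract q_circle)
  have cont: "continuous_on (sphere 0 1) (f a b)" if "a < N" "b < N" for a b
  proof -
    have "continuous_on (sphere 0 1) (\<lambda>z. poly (S $$ (a, b)) z / poly q z)"
      using q_circle by (auto intro!: continuous_intros)
    then show ?thesis using f[OF that] by (subst continuous_on_cong) auto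
  qed
  have "\<exists>B. \<forall>z. norm z = 1 \<longrightarrow> norm (f a b z) \<le> B" if "a < N" "b < N" for a b
    using compact_continuous_image[OF cont[OF that], THEN compact_imp_bounded]
    by (force simp: bounded_iff)
  then obtain B where B: "\<And>a b z. a < N \<Longrightarrow> b < N \<Longrightarrow> norm z = 1 \<Longrightarrow> norm (f a b z) \<le> B a b"
    by metis
  define B' where "B' = (\<Sum>a<N. \<Sum>b<N. \<bar>B a b\<bar>)"
  have B': "norm (f a b z) \<le> B'" if "a < N" "b < N" "norm z = 1" for a b z
  proof -
    have "norm (f a b z) \<le> \<bar>B a b\<bar>" using B[OF that] by linarith
    also have "\<dots> \<le> (\<Sum>b<N. \<bar>B a b\<bar>)" using that by (intro member_le_sum) auto
    also have "\<dots> \<le> B'" unfolding B'_def using that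
      by (intro member_le_sum[of a "{..<N}" "\<lambda>a. \<Sum>b<N. \<bar>B a b\<bar>"]) (auto intro: sum_nonneg)
    finally show ?thesis .
  qed
  obtain \<rho> where \<rho>: "0 < \<rho>" "\<rho> < 1"
    and expand: "\<And>u. degree u < degree d \<Longrightarrow> \<exists>c C. \<forall>n z. norm z = 1 \<longrightarrow>
       norm (poly u z / poly d z - (\<Sum>k<n. c k / z ^ Suc k)) \<le> C * \<rho> ^ n"
    using expansion_at_infinity[OF \<open>d \<noteq> 0\<close> d] by metis
  obtain c C where c: "\<And>a n z. a < N \<Longrightarrow> norm z = 1 \<Longrightarrow>
      norm (poly (u a) z / poly d z - (\<Sum>k<n. c a k / z ^ Suc k)) \<le> C a * \<rho> ^ n"
    using expand[OF deg] by metis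
  define C' where "C' = (\<Sum>a<N. \<bar>C a\<bar>)"
  have C': "norm (poly (u a) z / poly d z - (\<Sum>k<n. c a k / z ^ Suc k)) \<le> C' * \<rho> ^ n"
    if "a < N" "norm z = 1" for a n z
  proof -
    have "C a \<le> \<bar>C a\<bar>" by simp
    also have "\<bar>C a\<bar> \<le> C'"
      unfolding C'_def using that by (intro member_le_sum) auto
    finally have "C a * \<rho> ^ n \<le> C' * \<rho> ^ n" using \<rho> by (simp add: mult_right_mono)
    with c[OF that, of n] show ?thesis by linarith
  qed
  define K where "K = real N * (C' * B') + 1"
  have "C' \<ge> 0" "B' \<ge> 0" by (auto simp: C'_def B'_def intro: sum_nonneg)
  then have "K > 0" by (simp add: K_def add_nonneg_pos)
  obtain R where R: "R > 1" "\<And>z. norm z < R \<Longrightarrow> poly q\<^sub>2 z \<noteq> 0"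
    using poly_nonzero_on_larger_disk[OF q2] by blast
  have small: "norm (\<Sum>a<N. \<Sum>k<n. c a k * fourier_coeff (f a b) (int k - int j)) \<le> K * \<rho> ^ n"
    if b: "b < N" for b n j
  proof -
    obtain w where w: "(\<Sum>a<N. u a * S $$ (a, b)) = d * q\<^sub>1 * w"
      using dvd[OF b] by blast
    have "norm (\<Sum>a<N. \<Sum>k<n. c a k * fourier_coeff (f a b) (int k - int j))
        \<le> real (card {..<N}) * (C' * \<rho> ^ n * B')"
    proof (rule fourier_truncated_annihilation[where y = "\<lambda>a z. poly (u a) z / poly d z"
          and g = "\<lambda>z. poly w z / poly q\<^sub>2 z" and R = R])
      show "(\<lambda>z. poly w z / poly q\<^sub>2 z) holomorphic_on ball 0 R"
        using R by (auto intro!: holomorphic_intros)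
      fix z :: complex assume z: "norm z = 1"
      have "(\<Sum>a<N. poly (u a) z / poly d z * f a b z)
          = (\<Sum>a<N. poly (u a) z * poly (S $$ (a, b)) z) / (poly d z * poly q z)"
        unfolding sum_divide_distrib by (intro sum.cong) (simp_all add: f b z)
      also have "(\<Sum>a<N. poly (u a) z * poly (S $$ (a, b)) z) = poly (d * q\<^sub>1 * w) z"
        by (simp add: poly_sum flip: w)
      also have "\<dots> / (poly d z * poly q z) = poly w z / poly q\<^sub>2 z"
        using d_circle[OF z] q1[OF z] by (simp add: q)
      finally show "(\<Sum>a<N. poly (u a) z / poly d z * f a b z) = poly w z / poly q\<^sub>2 z" .
    qed (use b B' C' cont R in auto)
    also have "\<dots> = real N * (C' * B') * \<rho> ^ n" by (simp add: mult_ac)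
    also have "\<dots> \<le> K * \<rho> ^ n" using \<rho> by (simp add: K_def)
    finally show ?thesis .
  qed
  \<comment> \<open>Some expansion coefficient is nonzero, as otherwise the remainder estimate would force an entry
    of \<open>u / d\<close> to vanish on the whole circle. This keeps the truncated vectors away from zero.\<close>
  obtain a0 k0 where a0: "a0 < N" "c a0 k0 \<noteq> 0"
  proof -
    obtain a where a: "a < N" "u a \<noteq> 0" using u_nz by blast
    have "\<exists>k. c a k \<noteq> 0"
    proof (rule ccontr)
      assume "\<not> ?thesis"
      then have le: "norm (poly (u a) z / poly d z) \<le> C' * \<rho> ^ n" if "norm z = 1" for n z
        using C'[OF a(1) that, of n] by simp
      have "(\<lambda>n. C' * \<rho> ^ n) \<longlonglongrightarrow> C' * 0"
        using \<rho> by (intro tendsto_mult_left LIMSEQ_realpow_zero) auto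
      then have "norm (poly (u a) z / poly d z) \<le> C' * 0" if "norm z = 1" for z
        using le[OF that] by (intro Lim_bounded2[where N = 0]) auto
      then have "sphere 0 1 \<subseteq> {z. poly (u a) z = 0}"
        using d_circle by force
      moreover have "infinite (sphere 0 1 :: complex set)"
      proof
        assume "finite (sphere 0 1 :: complex set)"
        then obtain w :: complex where "sphere 0 1 \<subseteq> {w}"
          using connected_sphere[of "0 :: complex" 1] by (auto simp: connected_finite_iff_sing)
        moreover have "1 \<in> sphere (0 :: complex) 1" "- 1 \<in> sphere (0 :: complex) 1" by auto
        ultimately have "(1 :: complex) = - 1" by blast
        then show False by simp
      qed
      ultimately show False
        using poly_roots_finite[OF a(2)] finite_subset by blast
    qed
    with a(1) that show ?thesis by blast
  qed
  show ?thesis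
  proof (cases "\<exists>a<N. \<exists>b<N. \<exists>h. fourier_coeff (f a b) h \<noteq> 0")
    case False
    have "condition_number (block_toeplitz N A n) = \<infinity>" if "n \<ge> 1" for n
      using that \<open>N \<ge> 1\<close> False
      by (intro condition_number_zero_matrix[OF block_toeplitz_carrier])
        (auto simp: block_toeplitz_def f_def)
    then show ?thesis by (intro exI[of _ 1]) auto
  next
    case True
    then obtain a b h where ab: "a < N" "b < N" and h: "fourier_coeff (f a b) h \<noteq> 0" by blast
    define \<gamma> where "\<gamma> = - ln \<rho> / 2"
    have "\<gamma> > 0" using \<rho> by (simp add: \<gamma>_def)
    define n0 where "n0 = Suc (max k0 (nat \<bar>h\<bar>))"
    define L where "L = norm (fourier_coeff (f a b) h) * norm (c a0 k0) / (real N * K)"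
    define c1 where "c1 = L * \<gamma>"
    define c2 where "c2 = exp (- \<gamma> * real n0) / (real n0 * real N)"
    have "L > 0" using h a0 \<open>K > 0\<close> \<open>N \<ge> 1\<close> by (simp add: L_def)
    \<comment> \<open>From \<open>n0\<close> on, the matrix contains both the nonzero Fourier coefficient of index \<open>h\<close> and the
      nonzero entry of the truncated vector in block \<open>k0\<close>.\<close>
    have "condition_number (block_toeplitz N A n) \<ge> ereal (min c1 c2 * exp (\<gamma> * real n))"
      if n: "n \<ge> 1" for n
    proof (cases "n < n0")
      case True
      have "c2 * exp (\<gamma> * real n) \<le> 1 / (real n0 * real N)"
        using True \<open>\<gamma> > 0\<close> by (simp add: c2_def divide_right_mono flip: exp_add)
      also have "\<dots> \<le> 1 / real (n * N)"
        using True n \<open>N \<ge> 1\<close> by (simp add: frac_le)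
      finally have "min c1 c2 * exp (\<gamma> * real n) \<le> 1 / real (n * N)"
        by (smt (verit) exp_gt_zero mult_right_mono)
      also have "ereal \<dots> \<le> condition_number (block_toeplitz N A n)"
        using n \<open>N \<ge> 1\<close> by (intro condition_number_ge_inverse_dim[OF block_toeplitz_carrier]) simp
      finally show ?thesis by simp
    next
      case False
      let ?T = "block_toeplitz N A n"
      define y where "y i = c (i mod N) (i div N)" for i
      have "norm (\<Sum>i<n * N. y i * ?T $$ (i, l)) \<le> K * \<rho> ^ n" if l: "l < n * N" for l
      proof -
        define j b' where "j = l div N" and "b' = l mod N"
        have jb: "j < n" "b' < N" "l = j * N + b'"
          using l \<open>N \<ge> 1\<close> by (auto simp: j_def b'_def less_mult_imp_div_less)
        have "(\<Sum>i<n * N. y i * ?T $$ (i, l))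
            = (\<Sum>k<n. \<Sum>a<N. c a k * fourier_coeff (f a b') (int k - int j))"
          unfolding sum_block_index
          by (intro sum.cong) (simp_all add: jb block_toeplitz_entry y_def f_def)
        also have "\<dots> = (\<Sum>a<N. \<Sum>k<n. c a k * fourier_coeff (f a b') (int k - int j))"
          by (rule sum.swap)
        finally show ?thesis using small[OF jb(2)] by simp
      qed
      \<comment> \<open>One of \<open>nat h\<close> and \<open>nat (- h)\<close> is \<open>0\<close> and their difference is \<open>h\<close>, so the two block indices
        point at the Fourier coefficient of index \<open>h\<close> for either sign.\<close>
      moreover have "k0 * N + a0 < n * N" "nat h * N + a < n * N" "nat (- h) * N + b < n * N"
        using False a0 ab by (auto simp: n0_def intro!: block_index_less)
      ultimately have "ereal (norm (?T $$ (nat h * N + a, nat (- h) * N + b)) * norm (y (k0 * N + a0))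
          / (real (n * N) * (K * \<rho> ^ n))) \<le> condition_number ?T"
        using \<open>K > 0\<close> \<rho> by (intro condition_number_ge_if_left_almost_null[OF block_toeplitz_carrier]) auto
      moreover have "?T $$ (nat h * N + a, nat (- h) * N + b) = fourier_coeff (f a b) h"
        using False ab by (subst block_toeplitz_entry) (auto simp: n0_def f_def)
      moreover have "y (k0 * N + a0) = c a0 k0" using a0 by (simp add: y_def)
      ultimately have "ereal (L / (real n * \<rho> ^ n)) \<le> condition_number ?T"
        by (simp add: L_def mult_ac)
      moreover have "c1 * exp (\<gamma> * real n) \<le> L / (real n * \<rho> ^ n)"
        unfolding c1_def \<gamma>_def using \<rho> \<open>L > 0\<close> n by (intro geometric_beats_linear) auto
      then have "min c1 c2 * exp (\<gamma> * real n) \<le> L / (real n * \<rho> ^ n)"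
        by (smt (verit) exp_gt_zero mult_right_mono)
      ultimately show ?thesis by (meson ereal_less_eq(3) order_trans)
    qed
    moreover have "min c1 c2 > 0"
      using \<open>L > 0\<close> \<open>\<gamma> > 0\<close> \<open>N \<ge> 1\<close> by (simp add: c1_def c2_def n0_def)
    ultimately show ?thesis using \<open>\<gamma> > 0\<close> by blast
  qed
qed

section \<open>The annihilator supplied by the Smith form\<close>

lemma smith_diagonal_dvd:
  fixes p :: "nat \<Rightarrow> 'a :: comm_semiring_1"
  assumes smith: "\<forall>j\<in>{2..N}. p (j - 1) dvd p j" and "i \<le> j" "1 \<le> i" "j \<le> N"
  shows "p i dvd p j"
  using \<open>i \<le> j\<close> \<open>j \<le> N\<close>
proof (induction j rule: dec_induct)
  case (step j)
  then have "p j dvd p (Suc j)"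
    using smith[rule_format, of "Suc j"] \<open>1 \<le> i\<close> by simp
  with step show ?case by (meson Suc_leD dvd_trans)
qed simp

theorem theorem3p9:
  fixes N r :: nat
    and S :: "complex poly mat"
    and q :: "complex poly"
    and A :: "complex poly fract mat"
    and p :: "nat \<Rightarrow> complex poly"
    and t :: "nat \<Rightarrow> complex"
    and \<beta> :: "nat \<Rightarrow> nat \<Rightarrow> nat"
    and \<kappa> :: "nat \<Rightarrow> int"
    and r_minus r_plus :: "nat \<Rightarrow> complex poly fract"
  assumes "N \<ge> 1"
    and "S \<in> carrier_mat N N"
    and "det S \<noteq> 0"
    and "\<And>z. norm z = 1 \<Longrightarrow> poly q z \<noteq> 0"
    and "A = map_mat (\<lambda>s. Fract s q) S"
    and "smith_diagonal N S p"
    and "bij_betw t {1..r} {z. norm z = 1 \<and> rat_zero_at (det A) z}"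
    and "\<And>j. j \<in> {1..N} \<Longrightarrow>
           Fract (p j) q =
             (\<Prod>i\<in>{1..r}. to_fract [:- t i, 1:] ^ \<beta> j i) * to_fract [:0, 1:] powi \<kappa> j
               * r_minus j * r_plus j"
    and "\<And>j. j \<in> {1..N} \<Longrightarrow> minus_factor (r_minus j)"
    and "\<And>j. j \<in> {1..N} \<Longrightarrow> plus_factor (r_plus j)"
    and "\<kappa> 1 \<ge> 0"
    and "\<kappa> N > 0"
  shows "\<exists>c \<gamma>. c > 0 \<and> \<gamma> > 0 \<and>
           (\<forall>n\<ge>1. condition_number (block_toeplitz N A n) \<ge> ereal (c * exp (\<gamma> * real n)))"
proof -
  from \<open>smith_diagonal N S p\<close> obtain G H where
    G: "G \<in> carrier_mat N N" and H: "H \<in> carrier_mat N N"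
    and S: "S = G * mat_diag N (\<lambda>i. p (Suc i)) * H"
    and monic: "\<forall>j\<in>{1..N}. lead_coeff (p j) = 1"
    and chain: "\<forall>j\<in>{2..N}. p (j - 1) dvd p j"
    unfolding smith_diagonal_def by blast
  have p_nz: "p j \<noteq> 0" if "j \<in> {1..N}" for j
    using monic[rule_format, OF that] by auto
  have "q \<noteq> 0" using assms(4)[of 1] by auto
  have t: "norm (t i) = 1" if "i \<in> {1..r}" for i
    using assms(7) that by (auto simp: bij_betw_def)
  define q\<^sub>1 where "q\<^sub>1 = inner_part q"
  define d where "d = inner_part (p N)"
  define l where "l = nat (\<kappa> N)"
  have degrees: "degree (inner_part (p j)) = degree q\<^sub>1 + nat (\<kappa> j)" if "j \<in> {1..N}" "\<kappa> j \<ge> 0" for j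
    unfolding q\<^sub>1_def degree_inner_part
    using size_inner_roots_of_representation[OF p_nz[OF that(1)] \<open>q \<noteq> 0\<close> t assms(8,9,10)] that by simp
  have degree_d: "degree d = degree q\<^sub>1 + l"
    using degrees[of N] assms(1,12) by (simp add: d_def l_def)
  define Q where "Q j = d div inner_part (p (Suc j))" for j
  have Q: "d = inner_part (p (Suc j)) * Q j" if "j < N" for j
    unfolding Q_def d_def using that p_nz[of N] assms(1)
    by (simp add: inner_part_dvd_mono smith_diagonal_dvd[OF chain])
  have "d \<noteq> 0" by (simp add: d_def)
  then have Q_nz: "Q j \<noteq> 0" if "j < N" for j
    using Q[OF that] by auto
  have degree_Q: "degree (Q j) \<le> l" if "j < N" for j
  proof -
    have "degree q\<^sub>1 \<le> degree (inner_part (p 1))"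
      using degrees[of 1] assms(1,11) by simp
    also have "\<dots> \<le> degree (inner_part (p (Suc j)))"
      using that p_nz[of "Suc j"] by (intro dvd_imp_degree_le inner_part_dvd_mono smith_diagonal_dvd[OF chain]) auto
    finally show ?thesis
      using arg_cong[OF Q[OF that], of degree] degree_d Q_nz[OF that] by (simp add: degree_mult_eq)
  qed
  have "N - 1 < N" "Q (N - 1) = 1" "l > 0"
    using assms(1,12) by (simp_all add: Q_def d_def l_def)
  then obtain v where v: "\<exists>a<N. v a \<noteq> 0" "\<And>a. a < N \<Longrightarrow> degree (v a) < l"
    and dvd_v: "\<And>j. j < N \<Longrightarrow> Q j dvd (\<Sum>a<N. v a * G $$ (a, j))"
    using exists_row_with_divisibilities[of l N Q "N - 1" "\<lambda>a j. G $$ (a, j)"] Q_nz degree_Q by blast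
  obtain q\<^sub>2 where q: "q = q\<^sub>1 * q\<^sub>2" and q2: "\<And>z. norm z < 1 \<Longrightarrow> poly q\<^sub>2 z \<noteq> 0"
    using inner_outer_factorization[OF \<open>q \<noteq> 0\<close>] unfolding q\<^sub>1_def by blast
  define u where "u a = v a * q\<^sub>1" for a
  show ?thesis
  proof (rule condition_number_exponential_if_annihilated[OF assms(1,2,5) q])
    show "poly q\<^sub>1 z \<noteq> 0" if "norm z = 1" for z
      using assms(4)[OF that] q by auto
    show "poly q\<^sub>2 z \<noteq> 0" if "norm z \<le> 1" for z
      using q2[of z] assms(4)[of z] q that by (cases "norm z = 1") auto
    show "d \<noteq> 0" by fact
    show "norm z < 1" if "poly d z = 0" for z
      using that norm_root_inner_part by (simp add: d_def)
    show "degree (u a) < degree d" if "a < N" for a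
      using degree_mult_le[of "v a" q\<^sub>1] v(2)[OF that] by (simp add: u_def degree_d)
    show "\<exists>a<N. u a \<noteq> 0"
      using v(1) by (auto simp: u_def q\<^sub>1_def)
    fix b assume b: "b < N"
    have entry: "S $$ (a, b) = (\<Sum>j<N. G $$ (a, j) * p (Suc j) * H $$ (j, b))" if "a < N" for a
      using that b G H by (simp add: S mat_diag_mult_right scalar_prod_def atLeast0LessThan)
    have "(\<Sum>a<N. u a * S $$ (a, b))
        = (\<Sum>a<N. \<Sum>j<N. q\<^sub>1 * (v a * G $$ (a, j) * p (Suc j) * H $$ (j, b)))"
      by (intro sum.cong refl) (simp add: entry u_def sum_distrib_left mult_ac)
    also have "\<dots> = (\<Sum>j<N. \<Sum>a<N. q\<^sub>1 * (v a * G $$ (a, j) * p (Suc j) * H $$ (j, b)))"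
      by (rule sum.swap)
    also have "\<dots> = q\<^sub>1 * (\<Sum>j<N. (\<Sum>a<N. v a * G $$ (a, j)) * p (Suc j) * H $$ (j, b))"
      by (simp only: sum_distrib_left sum_distrib_right)
    finally have "(\<Sum>a<N. u a * S $$ (a, b))
        = q\<^sub>1 * (\<Sum>j<N. (\<Sum>a<N. v a * G $$ (a, j)) * p (Suc j) * H $$ (j, b))" .
    moreover have "d dvd (\<Sum>j<N. (\<Sum>a<N. v a * G $$ (a, j)) * p (Suc j) * H $$ (j, b))"
    proof (rule dvd_sum)
      fix j assume "j \<in> {..<N}"
      then have j: "j < N" by simp
      have "Q j * inner_part (p (Suc j)) dvd (\<Sum>a<N. v a * G $$ (a, j)) * p (Suc j)"
        by (intro mult_dvd_mono dvd_v[OF j] inner_part_dvd)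
      then have "d dvd (\<Sum>a<N. v a * G $$ (a, j)) * p (Suc j)"
        by (subst Q[OF j]) (simp only: mult.commute)
      then show "d dvd (\<Sum>a<N. v a * G $$ (a, j)) * p (Suc j) * H $$ (j, b)"
        by (rule dvd_mult2)
    qed
    ultimately show "d * q\<^sub>1 dvd (\<Sum>a<N. u a * S $$ (a, b))"
      by (simp only: mult.commute[of d q\<^sub>1] mult_dvd_mono dvd_refl)
  qed
qed

end
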